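(* Let $U^->0$, $\nu<0$ and $x \notin\{0,1\}$ be real numbers, and let $(K_b)_{b\geqslant 1}$ be a sequence of complex numbers. For $1 \leqslant \ell \leqslant b$ put $$ Q_{b,\ell} = - \frac{\Gamma(b)\Gamma(1-b\nu)}{\Gamma(b-b\nu)} \, (U^-)^{\ell+1} \, \frac{x^{1-b}}{1-x} \; F(\ell - b,-b \nu;-b;x). $$ Then the unique solution $(E_b)_{b \geqslant 1}$ to the infinite lower-triangular linear system $$ \sum_{\ell = 1}^b (-1)^\ell \binom{b}{\ell} \, Q_{b,\ell} \, E_{\ell} = K_b, \qquad b \geqslant 1, $$ is given by $$ E_b = \frac{1-x}{(U^-)^{b+1}} \sum_{\ell = 1}^b (-1)^{\ell - 1} \binom{b}{\ell} F(\ell-b,\ell \nu;\ell;x) \, x^{\ell - 1} \frac{\Gamma(\ell - \ell \nu)}{\Gamma(\ell)\Gamma(1-\ell \nu)} \, K_\ell $$ for all $b \geqslant 1$.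
   Context: $\Gamma$ is the Euler Gamma function. $F(\alpha,\beta;\gamma;\cdot)$ is the Gauss hypergeometric function; for $1\leqslant \ell\leqslant b$ the functions used are the polynomials $F(\ell-b,-b\nu;-b;x) = \sum_{m=0}^{b-\ell} \frac{(\ell-b)_m(-b\nu)_m}{(-b)_m \, m!} x^m$ and $F(\ell-b,\ell\nu;\ell;x) = \sum_{m=0}^{b-\ell} \frac{(\ell-b)_m(\ell\nu)_m}{(\ell)_m \, m!} x^m$, where $(c)_0=1$ and $(c)_m = c(c+1)\cdots(c+m-1)$. *)

theory Defs
  imports "HOL-Analysis.Analysis"
begin

text \<open>The Gauss hypergeometric function, as the sum of its series. For a lower parameter
  \<open>c = - b\<close> with \<open>b\<close> a natural number the coefficients beyond degree \<open>b\<close> have denominator zero;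
  by the convention \<open>y / 0 = 0\<close> they vanish, which is the usual truncation when an upper
  parameter is one of \<open>0, -1, \<dots>, - b\<close>.\<close>

definition hypergeo_F :: "real \<Rightarrow> real \<Rightarrow> real \<Rightarrow> real \<Rightarrow> real" where
  "hypergeo_F \<alpha> \<beta> \<gamma> x = eval_fps (fps_hypergeo [\<alpha>, \<beta>] [\<gamma>] 1) x"

lemma hypergeo_F_terminating:
  assumes "l \<le> b"
  shows "hypergeo_F (real l - real b) \<beta> \<gamma> x =
    (\<Sum>m = 0..b - l. pochhammer (real l - real b) m * pochhammer \<beta> m /
      (pochhammer \<gamma> m * fact m) * x ^ m)"
proof -
  have "pochhammer (real l - real b) m = 0" if "m \<notin> {0..b - l}" for m
  proof -
    have "real l - real b = - real (b - l)" using assms by (simp add: of_nat_diff)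
    moreover have "b - l < m" using that by simp
    ultimately show ?thesis using pochhammer_of_nat_eq_0_lemma by metis
  qed
  then show ?thesis
    unfolding hypergeo_F_def eval_fps_def
    by (subst suminf_finite[of "{0..b - l}"]) auto
qed

definition Q :: "real \<Rightarrow> real \<Rightarrow> real \<Rightarrow> nat \<Rightarrow> nat \<Rightarrow> real" where
  "Q U \<nu> x b l =
    - (Gamma (real b) * Gamma (1 - real b * \<nu>) / Gamma (real b - real b * \<nu>))
    * U ^ (l + 1) * (x powi (1 - int b) / (1 - x))
    * hypergeo_F (real l - real b) (- (real b * \<nu>)) (- real b) x"

end

theory Submission
  imports Defs
begin

text \<open>
  After removal of the nonzero factors that depend on a single index, the claim is that the
  matrices with entries \<open>(-1)\<^sup>l (b choose l) F(l - b, - b \<nu>; - b; x)\<close> and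
  \<open>(-1)\<^sup>k (l choose k) F(k - l, k \<nu>; k; x)\<close> are inverse to each other. When the binomial
  coefficients are absorbed into the hypergeometric polynomials, the index \<open>l\<close> occurs in
  the first only through \<open>b - m choose l\<close> and in the second only through \<open>l choose k + m'\<close>
  (lemmas \<open>binomial_times_F_minus\<close> and \<open>binomial_times_F\<close>), where \<open>m\<close> and \<open>m'\<close> are the
  exponents of \<open>x\<close>. The matrix \<open>(-1)\<^sup>l (n choose l)\<close> is an involution
  (lemma \<open>binomial_alternating_orthogonality\<close>), so that the sum over \<open>l\<close> retains only the terms
  with \<open>m + m' = b - k\<close>. Every entry of the product is thus a single power of \<open>x\<close> times a
  convolution of Pochhammer symbols, and Vandermonde's identity, used twice, shows that this
  convolution vanishes off the diagonal (lemma \<open>pochhammer_weighted_convolution\<close>).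

  Behind the cancellation is the residue that proves Lagrange inversion: with
  \<open>w = t (1 - x t) powr (- \<nu>)\<close>, the entry of the product in row \<open>b\<close> and column \<open>k\<close> is the
  coefficient of \<open>1 / t\<close> in \<open>w powi (k - 1 - b) * w'\<close>, which is a derivative unless \<open>k = b\<close>.

  This gives a right inverse of the lower triangular system. Its diagonal is then nonzero, so
  forward substitution shows that the solution is unique (lemma \<open>lower_triangular_system_iff\<close>).
\<close>

section \<open>Lower triangular systems\<close>

text \<open>A right inverse suffices: it produces a solution, and it forces the diagonal entries
  \<open>M b b\<close> to be nonzero, so that each unknown is determined by the preceding ones.\<close>

lemma lower_triangular_system_iff:
  fixes M N :: "nat \<Rightarrow> nat \<Rightarrow> 'a :: field" and K E :: "nat \<Rightarrow> 'a"
  assumes inv: "\<And>b k. 1 \<le> k \<Longrightarrow> k \<le> b \<Longrightarrow> (\<Sum>l=k..b. M b l * N l k) = (if k = b then 1 else 0)"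
  shows "(\<forall>b\<ge>1. (\<Sum>l=1..b. M b l * E l) = K b) \<longleftrightarrow> (\<forall>b\<ge>1. E b = (\<Sum>l=1..b. N b l * K l))"
proof -
  define G where "G b = (\<Sum>k=1..b. N b k * K k)" for b
  have G: "(\<Sum>l=1..b. M b l * G l) = K b" if "b \<ge> 1" for b
  proof -
    have "(\<Sum>l=1..b. M b l * G l) = (\<Sum>l=1..b. \<Sum>k=1..l. M b l * N l k * K k)"
      by (simp add: G_def sum_distrib_left mult.assoc)
    also have "\<dots> = (\<Sum>k=1..b. \<Sum>l=k..b. M b l * N l k * K k)"
      unfolding sum.Sigma[OF finite_atLeastAtMost ballI[OF finite_atLeastAtMost]]
      by (intro sum.reindex_bij_witness[of _ prod.swap prod.swap]) auto
    also have "\<dots> = (\<Sum>k=1..b. (if k = b then 1 else 0) * K k)"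
      by (intro sum.cong refl) (use inv in \<open>simp flip: sum_distrib_right\<close>)
    also have "\<dots> = (\<Sum>k=1..b. if k = b then K k else 0)"
      by (intro sum.cong) auto
    also have "\<dots> = K b"
      using that by simp
    finally show ?thesis .
  qed
  have unique: "E b = G b" if E: "\<forall>b\<ge>1. (\<Sum>l=1..b. M b l * E l) = K b" and "b \<ge> 1" for b
    using \<open>b \<ge> 1\<close>
  proof (induction b rule: less_induct)
    case (less b)
    have split: "{1..b} = insert b {1..<b}"
      using less.prems by auto
    have "(\<Sum>l=1..b. M b l * E l) = (\<Sum>l=1..b. M b l * G l)"
      using E G less.prems by simp
    moreover have "(\<Sum>l=1..<b. M b l * E l) = (\<Sum>l=1..<b. M b l * G l)"
      using less.IH by simp
    ultimately have "M b b * E b = M b b * G b"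
      unfolding split by simp
    moreover have "M b b \<noteq> 0"
      using inv[of b b] less.prems by auto
    ultimately show ?case
      by simp
  qed
  show ?thesis
    unfolding G_def[symmetric]
  proof (intro iffI allI impI)
    fix b :: nat assume "\<forall>b\<ge>1. E b = G b" "b \<ge> 1"
    then have "(\<Sum>l=1..b. M b l * E l) = (\<Sum>l=1..b. M b l * G l)"
      by (intro sum.cong) auto
    then show "(\<Sum>l=1..b. M b l * E l) = K b"
      using G[OF \<open>b \<ge> 1\<close>] by simp
  qed (use unique in blast)
qed

section \<open>Binomial coefficients and Pochhammer symbols\<close>

text \<open>The trinomial revision \<open>(n choose l) (l choose j) = (n choose j) (n - j choose l - j)\<close>
  leaves the binomial expansion of \<open>(1 - 1) ^ (n - j)\<close>. The bounds \<open>k\<close> and \<open>b\<close> are loose on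
  purpose: the same range of \<open>l\<close> has to serve several pairs of \<open>j\<close> and \<open>n\<close>.\<close>

lemma binomial_alternating_orthogonality:
  fixes n j k b :: nat
  assumes "k \<le> j" "n \<le> b"
  shows "(\<Sum>l=k..b. (-1) ^ l * of_nat (n choose l) * of_nat (l choose j) :: 'a :: comm_ring_1)
    = (if n = j then (-1) ^ j else 0)"
proof (cases "j \<le> n")
  case True
  have "(\<Sum>l=k..b. (-1) ^ l * of_nat (n choose l) * of_nat (l choose j) :: 'a)
      = (\<Sum>l=j..n. (-1) ^ l * of_nat (n choose l) * of_nat (l choose j))"
    using assms by (intro sum.mono_neutral_right) (auto simp: not_le binomial_eq_0)
  also have "\<dots> = (\<Sum>l=j..n. (-1) ^ l * (of_nat (n choose j) * of_nat ((n - j) choose (l - j))))"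
    by (intro sum.cong refl) (simp add: choose_mult mult.assoc flip: of_nat_mult)
  also have "\<dots> = (\<Sum>i\<le>n-j. (-1) ^ (i + j) * (of_nat (n choose j) * of_nat ((n - j) choose i)))"
    using True by (intro sum.reindex_bij_witness[of _ "\<lambda>i. i + j" "\<lambda>l. l - j"]) auto
  also have "\<dots> = (-1) ^ j * of_nat (n choose j) *
      (\<Sum>i\<le>n-j. (-1) ^ i * of_nat ((n - j) choose i))"
    by (simp add: sum_distrib_left power_add mult_ac)
  also have "\<dots> = (if n = j then (-1) ^ j else 0)"
    using True choose_alternating_sum[of "n - j", where 'a = 'a] by auto
  finally show ?thesis .
next
  case False
  then have "(-1) ^ l * of_nat (n choose l) * of_nat (l choose j) = (0 :: 'a)" for l
    by (cases "l < j") (use False in \<open>simp_all add: binomial_eq_0\<close>)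
  then show ?thesis
    using False by simp
qed

lemma pochhammer_neg_of_nat:
  "pochhammer (- of_nat n) m = (-1) ^ m * fact m * (of_nat (n choose m) :: 'a :: field_char_0)"
  by (simp add: binomial_gbinomial gbinomial_pochhammer flip: power_add)

lemma pochhammer_of_nat_binomial:
  "of_nat (k + m) * pochhammer (of_nat k) m
    = of_nat k * fact m * (of_nat ((k + m) choose k) :: 'a :: field_char_0)"
proof -
  have "of_nat (k + m) * pochhammer (of_nat k :: 'a) m = of_nat k * pochhammer (of_nat k + 1) m"
    by (metis of_nat_add pochhammer_rec pochhammer_rec')
  also have "pochhammer (of_nat k + 1 :: 'a) m = fact m * of_nat ((k + m) choose m)"
    by (simp add: binomial_gbinomial gbinomial_pochhammer')
  also have "(k + m) choose m = (k + m) choose k"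
    using binomial_symmetric[of m "k + m"] by simp
  finally show ?thesis
    by (simp add: mult.assoc)
qed

lemma pochhammer_Vandermonde:
  fixes a c :: "'a :: field_char_0"
  shows "(\<Sum>i\<le>n. pochhammer a (n - i) / fact (n - i) * (pochhammer c i / fact i))
    = pochhammer (a + c) n / fact n"
proof -
  have "pochhammer (a + c) n / fact n
      = (\<Sum>i\<le>n. of_nat (n choose i) * pochhammer c i * pochhammer a (n - i) / fact n)"
    using pochhammer_binomial_sum[of c a n] by (simp add: add.commute sum_divide_distrib)
  also have "\<dots> = (\<Sum>i\<le>n. pochhammer a (n - i) / fact (n - i) * (pochhammer c i / fact i))"
    by (intro sum.cong refl) (simp add: binomial_fact field_simps)
  finally show ?thesis ..
qed

text \<open>The summand splits along \<open>k + i\<close>. The part with \<open>k\<close> is a Vandermonde convolution of degree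
  \<open>n\<close>. In the other part \<open>i\<close> cancels against \<open>fact i\<close>, and \<open>pochhammer (k * \<nu>) i\<close> loses its first
  factor \<open>k * \<nu>\<close>, which gives a Vandermonde convolution of degree \<open>n - 1\<close>. The first parameter is
  chosen so that the two add up to a multiple of
  \<open>pochhammer (- n * \<nu>) n + n * \<nu> * pochhammer (- n * \<nu> + 1) (n - 1) = 0\<close>.\<close>

lemma pochhammer_weighted_convolution:
  fixes \<nu> k :: "'a :: field_char_0"
  shows "(\<Sum>i\<le>n. pochhammer (- ((k + of_nat n) * \<nu>)) (n - i) / fact (n - i) *
      ((k + of_nat i) * (pochhammer (k * \<nu>) i / fact i))) = (if n = 0 then k else 0)"
proof (cases n)
  case (Suc p)
  define a where "a = - ((k + of_nat n) * \<nu>)"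
  have shift: "of_nat (Suc i) * (pochhammer (k * \<nu>) (Suc i) / fact (Suc i))
      = k * \<nu> * (pochhammer (k * \<nu> + 1) i / fact i)" for i
    by (simp add: pochhammer_rec field_simps del: of_nat_Suc)
  have "(\<Sum>i\<le>n. pochhammer a (n - i) / fact (n - i) *
        ((k + of_nat i) * (pochhammer (k * \<nu>) i / fact i)))
      = k * (\<Sum>i\<le>n. pochhammer a (n - i) / fact (n - i) * (pochhammer (k * \<nu>) i / fact i))
        + (\<Sum>i\<le>n. pochhammer a (n - i) / fact (n - i) *
            (of_nat i * (pochhammer (k * \<nu>) i / fact i)))"
    unfolding sum_distrib_left sum.distrib[symmetric] by (intro sum.cong refl) algebra
  also have "(\<Sum>i\<le>n. pochhammer a (n - i) / fact (n - i) *
            (of_nat i * (pochhammer (k * \<nu>) i / fact i)))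
      = (\<Sum>i\<le>p. pochhammer a (p - i) / fact (p - i) *
            (k * \<nu> * (pochhammer (k * \<nu> + 1) i / fact i)))"
    unfolding Suc sum.atMost_Suc_shift shift by simp
  also have "\<dots> = k * \<nu> * (\<Sum>i\<le>p. pochhammer a (p - i) / fact (p - i) *
            (pochhammer (k * \<nu> + 1) i / fact i))"
    by (simp add: sum_distrib_left mult_ac)
  also have "k * (\<Sum>i\<le>n. pochhammer a (n - i) / fact (n - i) * (pochhammer (k * \<nu>) i / fact i))
      + \<dots> = k * (pochhammer (a + k * \<nu>) n / fact n + \<nu> * (pochhammer (a + (k * \<nu> + 1)) p / fact p))"
    unfolding pochhammer_Vandermonde by algebra
  also have "a + k * \<nu> = - (of_nat n * \<nu>)"
    by (simp add: a_def algebra_simps)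
  also have "a + (k * \<nu> + 1) = - (of_nat n * \<nu>) + 1"
    by (simp add: a_def algebra_simps)
  also have "pochhammer (- (of_nat n * \<nu>)) n / fact n
      = - \<nu> * (pochhammer (- (of_nat n * \<nu>) + 1) p / fact p)"
    unfolding Suc by (simp add: pochhammer_rec field_simps del: of_nat_Suc)
  finally show ?thesis
    unfolding a_def using Suc by simp
qed simp

section \<open>The hypergeometric matrices\<close>

text \<open>The ratio of Pochhammer symbols is
  \<open>(b - l choose m) / (b choose m)\<close>, and \<open>(b choose l) (b - l choose m)\<close> is symmetric in \<open>l\<close> and
  \<open>m\<close>. The upper limit \<open>n\<close> pads the sum with zeros, so that one range of \<open>m\<close> serves every \<open>l\<close>;
  for \<open>m > b\<close> the truncated \<open>b - m\<close> is \<open>0\<close>, and \<open>0 choose l\<close> vanishes as \<open>l \<ge> 1\<close>.\<close>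

lemma binomial_times_F_minus:
  assumes "1 \<le> l" "l \<le> b" "b - l \<le> n"
  shows "real (b choose l) * hypergeo_F (real l - real b) \<beta> (- real b) x
    = (\<Sum>m\<le>n. real ((b - m) choose l) * (pochhammer \<beta> m / fact m * x ^ m))"
proof -
  have summand: "real (b choose l) * (pochhammer (real l - real b) m * pochhammer \<beta> m /
        (pochhammer (- real b) m * fact m) * x ^ m)
      = real ((b - m) choose l) * (pochhammer \<beta> m / fact m * x ^ m)" if m: "m \<le> b - l" for m
  proof -
    have diff: "real l - real b = - real (b - l)"
      using assms by (simp add: of_nat_diff)
    have "(b choose l) * ((b - l) choose m) = (b choose (l + m)) * ((l + m) choose l)"
      using choose_mult[of l "l + m" b] m assms by simp
    also have "(l + m) choose l = (l + m) choose m"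
      using binomial_symmetric[of l "l + m"] by simp
    also have "(b choose (l + m)) * ((l + m) choose m) = (b choose m) * ((b - m) choose l)"
      using choose_mult[of m "l + m" b] m assms by simp
    finally have "real (b choose l) * real ((b - l) choose m)
        = real (b choose m) * real ((b - m) choose l)"
      unfolding of_nat_mult[symmetric] by simp
    moreover have "real (b choose m) \<noteq> 0"
      using m assms by simp
    ultimately show ?thesis
      unfolding diff pochhammer_neg_of_nat by (simp add: field_simps)
  qed
  have "real (b choose l) * hypergeo_F (real l - real b) \<beta> (- real b) x
      = (\<Sum>m=0..b-l. real ((b - m) choose l) * (pochhammer \<beta> m / fact m * x ^ m))"
    unfolding hypergeo_F_terminating[OF assms(2)] sum_distrib_left
    by (intro sum.cong refl summand) simp
  also have "\<dots> = (\<Sum>m\<le>n. real ((b - m) choose l) * (pochhammer \<beta> m / fact m * x ^ m))"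
    using assms by (intro sum.mono_neutral_left) auto
  finally show ?thesis .
qed

text \<open>Here \<open>(l choose k) (l - k choose m) = (l choose k + m) (k + m choose k)\<close>, and the last
  factor, free of \<open>l\<close>, differs from \<open>pochhammer k m / fact m\<close> by \<open>(k + m) / k\<close>. This ratio is the
  weight in the convolution to which the product of the matrices reduces.\<close>

lemma binomial_times_F:
  assumes "1 \<le> k" "k \<le> l" "l - k \<le> n"
  shows "real (l choose k) * hypergeo_F (real k - real l) \<beta> (real k) x
    = (\<Sum>m\<le>n. (-1) ^ m * real (l choose (k + m)) *
        ((real k + real m) / real k * (pochhammer \<beta> m / fact m) * x ^ m))"
proof -
  have summand: "real (l choose k) * (pochhammer (real k - real l) m * pochhammer \<beta> m /
        (pochhammer (real k) m * fact m) * x ^ m)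
      = (-1) ^ m * real (l choose (k + m)) *
        ((real k + real m) / real k * (pochhammer \<beta> m / fact m) * x ^ m)" if m: "m \<le> l - k" for m
  proof -
    have diff: "real k - real l = - real (l - k)"
      using assms by (simp add: of_nat_diff)
    have "(l choose k) * ((l - k) choose m) = (l choose (k + m)) * ((k + m) choose k)"
      using choose_mult[of k "k + m" l] m assms by simp
    then have "real (l choose k) * real ((l - k) choose m)
        = real (l choose (k + m)) * real ((k + m) choose k)"
      unfolding of_nat_mult[symmetric] by simp
    moreover have "real ((k + m) choose k)
        = (real k + real m) * pochhammer (real k) m / (real k * fact m)"
      using pochhammer_of_nat_binomial[of k m, where 'a = real] assms by (simp add: field_simps)
    ultimately have *: "real (l choose k) * real ((l - k) choose m)
        = real (l choose (k + m)) * ((real k + real m) * pochhammer (real k) m / (real k * fact m))"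
      by simp
    have nz: "pochhammer (real k) m \<noteq> 0"
      using assms by (intro less_imp_neq[symmetric] pochhammer_pos) simp
    have "real (l choose k) * (pochhammer (real k - real l) m * pochhammer \<beta> m /
        (pochhammer (real k) m * fact m) * x ^ m)
      = (-1) ^ m * (real (l choose k) * real ((l - k) choose m)) * pochhammer \<beta> m /
        pochhammer (real k) m * x ^ m"
      unfolding diff pochhammer_neg_of_nat by simp
    then show ?thesis
      unfolding * using nz by simp
  qed
  have "real (l choose k) * hypergeo_F (real k - real l) \<beta> (real k) x
      = (\<Sum>m=0..l-k. (-1) ^ m * real (l choose (k + m)) *
        ((real k + real m) / real k * (pochhammer \<beta> m / fact m) * x ^ m))"
    unfolding hypergeo_F_terminating[OF assms(2)] sum_distrib_left
    by (intro sum.cong refl summand) simp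
  also have "\<dots> = (\<Sum>m\<le>n. (-1) ^ m * real (l choose (k + m)) *
        ((real k + real m) / real k * (pochhammer \<beta> m / fact m) * x ^ m))"
    using assms by (intro sum.mono_neutral_left) auto
  finally show ?thesis .
qed

text \<open>Orthogonality over \<open>l\<close> forces \<open>b - m = k + i\<close>, that is \<open>m + i = b - k\<close>, where \<open>m\<close> and \<open>i\<close>
  are the exponents of \<open>x\<close> in the two polynomials; what remains is the weighted convolution.\<close>

lemma hypergeo_F_matrix_inverse:
  assumes "1 \<le> k" "k \<le> b"
  shows "(\<Sum>l=k..b. (-1) ^ l *
      (real (b choose l) * hypergeo_F (real l - real b) (- (real b * \<nu>)) (- real b) x) *
      (real (l choose k) * hypergeo_F (real k - real l) (real k * \<nu>) (real k) x))
    = (if k = b then (-1) ^ k else 0)"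
proof -
  define n where "n = b - k"
  define p where "p m = pochhammer (- (real b * \<nu>)) m / fact m" for m
  define q where "q m = (real k + real m) / real k * (pochhammer (real k * \<nu>) m / fact m)" for m
  have "(\<Sum>l=k..b. (-1) ^ l *
      (real (b choose l) * hypergeo_F (real l - real b) (- (real b * \<nu>)) (- real b) x) *
      (real (l choose k) * hypergeo_F (real k - real l) (real k * \<nu>) (real k) x))
    = (\<Sum>l=k..b. (-1) ^ l * (\<Sum>m\<le>n. real ((b - m) choose l) * (p m * x ^ m)) *
        (\<Sum>i\<le>n. (-1) ^ i * real (l choose (k + i)) * (q i * x ^ i)))"
    using assms unfolding p_def q_def n_def
    by (intro sum.cong refl arg_cong2[of _ _ _ _ "(*)"] binomial_times_F_minus binomial_times_F) auto
  also have "\<dots> = (\<Sum>l=k..b. \<Sum>m\<le>n. \<Sum>i\<le>n. (-1) ^ i * (p m * q i * x ^ (m + i)) *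
        ((-1) ^ l * real ((b - m) choose l) * real (l choose (k + i))))"
    by (subst mult.assoc, subst sum_product) (simp add: sum_distrib_left power_add mult_ac)
  also have "\<dots> = (\<Sum>m\<le>n. \<Sum>l=k..b. \<Sum>i\<le>n. (-1) ^ i * (p m * q i * x ^ (m + i)) *
        ((-1) ^ l * real ((b - m) choose l) * real (l choose (k + i))))"
    by (rule sum.swap)
  also have "\<dots> = (\<Sum>m\<le>n. \<Sum>i\<le>n. \<Sum>l=k..b. (-1) ^ i * (p m * q i * x ^ (m + i)) *
        ((-1) ^ l * real ((b - m) choose l) * real (l choose (k + i))))"
    by (intro sum.cong refl sum.swap)
  also have "\<dots> = (\<Sum>m\<le>n. \<Sum>i\<le>n. (-1) ^ i * (p m * q i * x ^ (m + i)) *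
        (if b - m = k + i then (-1) ^ (k + i) else 0))"
    by (simp add: binomial_alternating_orthogonality flip: sum_distrib_left)
  also have "\<dots> = (\<Sum>i\<le>n. \<Sum>m\<le>n. (-1) ^ i * (p m * q i * x ^ (m + i)) *
        (if b - m = k + i then (-1) ^ (k + i) else 0))"
    by (rule sum.swap)
  also have "\<dots> = (\<Sum>i\<le>n. \<Sum>m\<le>n. if m = n - i then (-1) ^ k * x ^ n * (p m * q i) else 0)"
  proof (intro sum.cong refl)
    fix i m assume "i \<in> {..n}" "m \<in> {..n}"
    then have "b - m = k + i \<longleftrightarrow> m = n - i" and "m = n - i \<Longrightarrow> m + i = n"
      using assms by (auto simp: n_def)
    then show "(-1) ^ i * (p m * q i * x ^ (m + i)) * (if b - m = k + i then (-1) ^ (k + i) else 0)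
        = (if m = n - i then (-1) ^ k * x ^ n * (p m * q i) else 0)"
      by (cases "m = n - i") (simp_all add: power_add mult_ac flip: power_mult_distrib)
  qed
  also have "\<dots> = (\<Sum>i\<le>n. (-1) ^ k * x ^ n * (p (n - i) * q i))"
    by (intro sum.cong refl) simp
  also have "\<dots> = (-1) ^ k * x ^ n / real k *
      (\<Sum>i\<le>n. p (n - i) * ((real k + real i) * (pochhammer (real k * \<nu>) i / fact i)))"
    unfolding sum_distrib_left by (intro sum.cong refl) (simp add: q_def)
  also have "(\<Sum>i\<le>n. p (n - i) * ((real k + real i) * (pochhammer (real k * \<nu>) i / fact i)))
      = (if n = 0 then real k else 0)"
    using pochhammer_weighted_convolution[of "real k" n \<nu>] assms
    by (simp add: p_def n_def of_nat_diff)
  finally show ?thesis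
    using assms by (auto simp: n_def)
qed

theorem corollary4p1:
  fixes U \<nu> x :: real and K E :: "nat \<Rightarrow> complex"
  assumes "U > 0" and "\<nu> < 0" and "x \<notin> {0, 1}"
  shows "(\<forall>b\<ge>1. (\<Sum>l = 1..b.
             (-1) ^ l * of_nat (b choose l) * complex_of_real (Q U \<nu> x b l) * E l) = K b)
     \<longleftrightarrow>
         (\<forall>b\<ge>1. E b = complex_of_real ((1 - x) / U ^ (b + 1)) *
           (\<Sum>l = 1..b. (-1) ^ (l - 1) * of_nat (b choose l)
              * complex_of_real (hypergeo_F (real l - real b) (real l * \<nu>) (real l) x
                  * x ^ (l - 1)
                  * (Gamma (real l - real l * \<nu>) / (Gamma (real l) * Gamma (1 - real l * \<nu>))))
              * K l))"
proof -
  define g where "g b = Gamma (real b) * Gamma (1 - real b * \<nu>) / Gamma (real b - real b * \<nu>)" for b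
  define M where "M b l = (-1) ^ l * real (b choose l) * Q U \<nu> x b l" for b l
  define N where "N l k = (1 - x) / U ^ (l + 1) * ((-1) ^ (k - 1) * real (l choose k)
      * (hypergeo_F (real k - real l) (real k * \<nu>) (real k) x * x ^ (k - 1)
      * (Gamma (real k - real k * \<nu>) / (Gamma (real k) * Gamma (1 - real k * \<nu>)))))" for l k
  have g_nonzero: "g b \<noteq> 0" if "b \<ge> 1" for b
  proof -
    have "real b * \<nu> < 0"
      using that assms by (simp add: mult_pos_neg)
    then have "Gamma (real b) > 0" "Gamma (1 - real b * \<nu>) > 0" "Gamma (real b - real b * \<nu>) > 0"
      using that assms(2) by (auto intro!: Gamma_real_pos)
    then show ?thesis
      by (simp add: g_def)
  qed
  have MN: "(\<Sum>l=k..b. M b l * N l k) = (if k = b then 1 else 0)" if "1 \<le> k" "k \<le> b" for b k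
  proof -
    \<comment> \<open>The factors outside the sum over \<open>l\<close>. The powers of \<open>U\<close> and \<open>1 - x\<close> cancel within each
      summand, and so do the minus signs in \<open>Q\<close> and in \<open>(-1) ^ (k - 1) = - ((-1) ^ k)\<close>.\<close>
    define c where "c = (-1) ^ k * (g b / g k) * (x powi (1 - int b) * x ^ (k - 1))"
    have "M b l * N l k = c * ((-1) ^ l *
        (real (b choose l) * hypergeo_F (real l - real b) (- (real b * \<nu>)) (- real b) x) *
        (real (l choose k) * hypergeo_F (real k - real l) (real k * \<nu>) (real k) x))" for l
    proof -
      have "Gamma (real k - real k * \<nu>) / (Gamma (real k) * Gamma (1 - real k * \<nu>)) = 1 / g k"
        by (simp add: g_def)
      moreover have "(-1 :: real) ^ (k - 1) = - ((-1) ^ k)"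
        using that by (cases k) auto
      moreover have "1 - x \<noteq> 0" "U ^ (l + 1) \<noteq> 0"
        using assms by auto
      ultimately show ?thesis
        unfolding M_def N_def Q_def c_def g_def[symmetric] by simp
    qed
    then have "(\<Sum>l=k..b. M b l * N l k) = c * (if k = b then (-1) ^ k else 0)"
      using hypergeo_F_matrix_inverse[OF that, of \<nu> x] by (simp flip: sum_distrib_left)
    moreover have "c = (-1) ^ k" if "k = b"
    proof -
      have "x powi (1 - int b) * x ^ (b - 1) = x powi (1 - int b) * x powi int (b - 1)"
        by simp
      also have "\<dots> = x powi (1 - int b + int (b - 1))"
        using assms by (intro power_int_add[symmetric]) auto
      also have "1 - int b + int (b - 1) = 0"
        using \<open>1 \<le> k\<close> that by simp
      finally show ?thesis
        using that g_nonzero[of b] \<open>1 \<le> k\<close> by (simp add: c_def)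
    qed
    ultimately show ?thesis
      by (simp flip: power_add)
  qed
  have "(\<Sum>l=k..b. complex_of_real (M b l) * complex_of_real (N l k)) = (if k = b then 1 else 0)"
    if "1 \<le> k" "k \<le> b" for b k
    using MN[OF that] by (simp flip: of_real_mult of_real_sum)
  note lower_triangular_system_iff[OF this, of E K]
  moreover have "complex_of_real (M b l)
      = (-1) ^ l * of_nat (b choose l) * complex_of_real (Q U \<nu> x b l)" for b l
    by (simp add: M_def)
  moreover have "(\<Sum>l=1..b. complex_of_real (N b l) * K l)
      = complex_of_real ((1 - x) / U ^ (b + 1)) *
           (\<Sum>l = 1..b. (-1) ^ (l - 1) * of_nat (b choose l)
              * complex_of_real (hypergeo_F (real l - real b) (real l * \<nu>) (real l) x
                  * x ^ (l - 1)
                  * (Gamma (real l - real l * \<nu>) / (Gamma (real l) * Gamma (1 - real l * \<nu>))))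
              * K l)" for b
    unfolding sum_distrib_left by (intro sum.cong refl) (simp add: N_def)
  ultimately show ?thesis
    by simp
qed

end
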